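(* Let $G$ be a bridgeless graph and let $d\ge2$, $k\ge2$, $l\ge1$ be integers. Suppose $G$ admits an oriented $k$-cycle $2l$-cover $\{C_1,\dots,C_k\}$. Then for any vectors $P_1,\dots,P_k\in\mathbb{R}^d$, $G$ admits a vector $\Omega$-flow, where $$\Omega=\Bigl\{\sum_{i\in I}P_i-\sum_{j\in J}P_j : I,J\subseteq\{1,\dots,k\},\ |I|=|J|=l,\ I\cap J=\varnothing\Bigr\}.$$
   Context: All graphs are finite and may have multiple edges but no loops. A cycle is a subgraph in which every vertex has even degree; a cycle in a directed graph is directed if every vertex has equal in- and out-degree. An oriented $k$-cycle $2l$-cover of $G$ is a family of $k$ directed cycles such that each edge of $G$ is covered exactly $2l$ times, $l$ times in each direction. For an orientation $D$ and vertex $v$, $E_D^+(v)$, $E_D^-(v)$ are the out- and in-edges. For $\Omega\subseteq\mathbb{R}^d$, a vector $\Omega$-flow of $G$ is a pair $(D,f)$ with $D$ an orientation of $G$ and $f:E(G)\to\Omega$ satisfying $\sum_{e\in E_D^+(v)}f(e)-\sum_{e\in E_D^-(v)}f(e)=\mathbf{0}$ at every vertex $v$. *)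

theory Defs
  imports "HOL-Analysis.Analysis" "Graph_Theory.Digraph"
begin

text \<open>
  An undirected multigraph assigns to every edge its unordered pair of ends; parallel edges are
  different elements of \<open>medges\<close> with the same ends. Orientations and directed cycles are
  represented as digraphs of type \<open>pre_digraph\<close> over the same vertices and edge names.
\<close>

record ('v, 'e) multigraph =
  mverts :: "'v set"
  medges :: "'e set"
  mends :: "'e \<Rightarrow> 'v set"

definition loopless_multigraph :: "('v, 'e) multigraph \<Rightarrow> bool" where
  "loopless_multigraph G \<longleftrightarrow> finite (mverts G) \<and> finite (medges G) \<and>
     (\<forall>e\<in>medges G. mends G e \<subseteq> mverts G \<and> card (mends G e) = 2)"

definition msubgraph :: "('v, 'e) multigraph \<Rightarrow> ('v, 'e) multigraph \<Rightarrow> bool" where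
  "msubgraph H G \<longleftrightarrow> loopless_multigraph H \<and> mverts H \<subseteq> mverts G \<and> medges H \<subseteq> medges G \<and>
     (\<forall>e\<in>medges H. mends H e = mends G e)"

definition mdegree :: "('v, 'e) multigraph \<Rightarrow> 'v \<Rightarrow> nat" where
  "mdegree G v = card {e \<in> medges G. v \<in> mends G e}"

definition madj :: "('v, 'e) multigraph \<Rightarrow> ('v \<times> 'v) set" where
  "madj G = {(u, v). \<exists>e\<in>medges G. mends G e = {u, v}}"

text \<open>The vertex sets of the connected components.\<close>

definition mcomponents :: "('v, 'e) multigraph \<Rightarrow> 'v set set" where
  "mcomponents G = (\<lambda>v. {w. (v, w) \<in> (madj G)\<^sup>*}) ` mverts G"

definition mdelete_edge :: "('v, 'e) multigraph \<Rightarrow> 'e \<Rightarrow> ('v, 'e) multigraph" where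
  "mdelete_edge G e = G\<lparr>medges := medges G - {e}\<rparr>"

definition bridge :: "('v, 'e) multigraph \<Rightarrow> 'e \<Rightarrow> bool" where
  "bridge G e \<longleftrightarrow> e \<in> medges G \<and> card (mcomponents G) < card (mcomponents (mdelete_edge G e))"

definition bridgeless :: "('v, 'e) multigraph \<Rightarrow> bool" where
  "bridgeless G \<longleftrightarrow> (\<forall>e\<in>medges G. \<not> bridge G e)"

definition orientation :: "('v, 'e) multigraph \<Rightarrow> ('v, 'e) pre_digraph \<Rightarrow> bool" where
  "orientation G D \<longleftrightarrow> verts D = mverts G \<and> arcs D = medges G \<and>
     (\<forall>e\<in>medges G. {tail D e, head D e} = mends G e)"

text \<open>
  Cycles need not be connected and may be edgeless. A directed cycle is a cycle together with an
  orientation of its edges, so it uses each of its edges in exactly one direction.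
\<close>

definition cycle_in :: "('v, 'e) multigraph \<Rightarrow> ('v, 'e) multigraph \<Rightarrow> bool" where
  "cycle_in G H \<longleftrightarrow> msubgraph H G \<and> (\<forall>v\<in>mverts H. even (mdegree H v))"

definition directed_cycle_in :: "('v, 'e) multigraph \<Rightarrow> ('v, 'e) pre_digraph \<Rightarrow> bool" where
  "directed_cycle_in G C \<longleftrightarrow> (\<exists>H. cycle_in G H \<and> orientation H C) \<and>
     (\<forall>v\<in>verts C. in_degree C v = out_degree C v)"

definition oriented_cycle_cover ::
    "('v, 'e) multigraph \<Rightarrow> nat \<Rightarrow> nat \<Rightarrow> (nat \<Rightarrow> ('v, 'e) pre_digraph) \<Rightarrow> bool" where
  "oriented_cycle_cover G k l C \<longleftrightarrow>
     (\<forall>i\<in>{1..k}. directed_cycle_in G (C i)) \<and>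
     (\<forall>e\<in>medges G. card {i\<in>{1..k}. e \<in> arcs (C i)} = 2 * l \<and>
        (\<forall>u v. mends G e = {u, v} \<longrightarrow>
           card {i\<in>{1..k}. e \<in> arcs (C i) \<and> tail (C i) e = u \<and> head (C i) e = v} = l))"

definition vector_flow ::
    "('v, 'e) multigraph \<Rightarrow> (real ^ 'd) set \<Rightarrow> ('v, 'e) pre_digraph \<Rightarrow> ('e \<Rightarrow> real ^ 'd) \<Rightarrow> bool" where
  "vector_flow G \<Omega> D f \<longleftrightarrow> orientation G D \<and> (\<forall>e\<in>medges G. f e \<in> \<Omega>) \<and>
     (\<forall>v\<in>mverts G. (\<Sum>e\<in>out_arcs D v. f e) - (\<Sum>e\<in>in_arcs D v. f e) = 0)"

end

theory Submission
  imports Defs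
begin

text \<open>
  Orient \<open>G\<close> arbitrarily and give an edge the sum of the vectors \<open>P i\<close> of the cycles traversing it
  along the orientation minus the sum over those traversing it backwards. This is the superposition
  of the circulations \<open>P i\<close> times the directed cycle \<open>C i\<close>, hence a flow.
\<close>

text \<open>This is the signed vertex-edge incidence matrix of \<open>D\<close>. With it, net
  outflow at a vertex becomes one sum over all arcs, linear in the flow.\<close>

definition arc_sign :: "('v, 'e) pre_digraph \<Rightarrow> 'e \<Rightarrow> 'v \<Rightarrow> real" where
  "arc_sign D e v = of_bool (tail D e = v) - of_bool (head D e = v)"

lemma net_outflow_eq_arc_sign:
  fixes f :: "'e \<Rightarrow> 'a::real_vector"
  assumes "finite (arcs D)"
  shows "(\<Sum>e\<in>out_arcs D v. f e) - (\<Sum>e\<in>in_arcs D v. f e) = (\<Sum>e\<in>arcs D. arc_sign D e v *\<^sub>R f e)"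
proof -
  have "(\<Sum>e\<in>out_arcs D v. f e) = (\<Sum>e\<in>arcs D. of_bool (tail D e = v) *\<^sub>R f e)"
    unfolding out_arcs_def using assms by (intro sum.mono_neutral_cong_left) auto
  moreover have "(\<Sum>e\<in>in_arcs D v. f e) = (\<Sum>e\<in>arcs D. of_bool (head D e = v) *\<^sub>R f e)"
    unfolding in_arcs_def using assms by (intro sum.mono_neutral_cong_left) auto
  ultimately show ?thesis
    by (simp add: arc_sign_def scaleR_left_diff_distrib sum_subtractf)
qed

lemma orientation_exists:
  assumes "loopless_multigraph G"
  shows "\<exists>D. orientation G D"
proof -
  have "\<forall>e\<in>medges G. \<exists>u w. mends G e = {u, w}"
    using assms by (fastforce simp: loopless_multigraph_def card_2_iff)
  then obtain t h where "\<forall>e\<in>medges G. mends G e = {t e, h e}"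
    by metis
  then have "orientation G \<lparr>verts = mverts G, arcs = medges G, tail = t, head = h\<rparr>"
    by (simp add: orientation_def)
  then show ?thesis ..
qed

lemma directed_cycle_in_arcs:
  assumes "directed_cycle_in G C"
  shows "arcs C \<subseteq> medges G" and "\<And>e. e \<in> arcs C \<Longrightarrow> {tail C e, head C e} = mends G e"
  using assms unfolding directed_cycle_in_def cycle_in_def msubgraph_def orientation_def
  by (blast, metis)

text \<open>Each directed cycle is a circulation with constant value 1. The vertex \<open>v\<close>
  is arbitrary because the cycle may miss vertices of \<open>G\<close>: on the cycle, in- and
  out-degree agree; off it, every summand vanishes.\<close>

lemma directed_cycle_in_balanced:
  assumes "directed_cycle_in G C"
  shows "(\<Sum>e\<in>arcs C. arc_sign C e v) = 0"
proof -
  obtain H where H: "loopless_multigraph H" "orientation H C"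
    using assms by (auto simp: directed_cycle_in_def cycle_in_def msubgraph_def)
  then have fin: "finite (arcs C)"
    by (simp add: loopless_multigraph_def orientation_def)
  have ends: "tail C e \<in> verts C \<and> head C e \<in> verts C" if "e \<in> arcs C" for e
  proof -
    have "{tail C e, head C e} \<subseteq> verts C"
      using H that by (simp add: loopless_multigraph_def orientation_def)
    then show ?thesis by simp
  qed
  show ?thesis
  proof (cases "v \<in> verts C")
    case True
    then have "card (out_arcs C v) = card (in_arcs C v)"
      using assms by (simp add: directed_cycle_in_def in_degree_def out_degree_def)
    then show ?thesis
      using net_outflow_eq_arc_sign[OF fin, where f = "\<lambda>_. 1::real" and v = v] by simp
  next
    case False
    then show ?thesis
      using ends by (intro sum.neutral) (auto simp: arc_sign_def)
  qed
qed

definition traversing ::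
    "nat \<Rightarrow> (nat \<Rightarrow> ('v, 'e) pre_digraph) \<Rightarrow> 'e \<Rightarrow> 'v \<Rightarrow> 'v \<Rightarrow> nat set" where
  "traversing k C e u v = {i\<in>{1..k}. e \<in> arcs (C i) \<and> tail (C i) e = u \<and> head (C i) e = v}"

theorem theorem4p1:
  fixes G :: "('v, 'e) multigraph"
    and k l :: nat
    and C :: "nat \<Rightarrow> ('v, 'e) pre_digraph"
    and P :: "nat \<Rightarrow> real ^ 'd"
  assumes "loopless_multigraph G"
    and "bridgeless G"
    and "CARD('d) \<ge> 2" and "k \<ge> 2" and "l \<ge> 1"
    and "oriented_cycle_cover G k l C"
  shows "\<exists>D f. vector_flow G
           {(\<Sum>i\<in>I. P i) - (\<Sum>j\<in>J. P j) | I J.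
              I \<subseteq> {1..k} \<and> J \<subseteq> {1..k} \<and> card I = l \<and> card J = l \<and> I \<inter> J = {}} D f"
proof -
  obtain D where D: "orientation G D"
    using orientation_exists assms(1) by blast
  have arcs_D: "arcs D = medges G" and fin: "finite (medges G)"
    and ends: "\<And>e. e \<in> medges G \<Longrightarrow> mends G e = {tail D e, head D e}"
    using D assms(1) by (auto simp: orientation_def loopless_multigraph_def)
  \<comment> \<open>Distinct ends keep the two traversal directions apart; this makes
    \<open>I e\<close> and \<open>J e\<close> disjoint and the coefficients below
    well-behaved.\<close>
  have neq: "tail D e \<noteq> head D e" if "e \<in> medges G" for e
    using that ends[OF that] assms(1) by (auto simp: loopless_multigraph_def)
  have cyc: "directed_cycle_in G (C i)" if "i \<in> {1..k}" for i
    using assms(6) that by (simp add: oriented_cycle_cover_def)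
  define I where "I e = traversing k C e (tail D e) (head D e)" for e
  define J where "J e = traversing k C e (head D e) (tail D e)" for e
  define f where "f e = (\<Sum>i\<in>I e. P i) - (\<Sum>j\<in>J e. P j)" for e
  have sub: "I e \<subseteq> {1..k}" "J e \<subseteq> {1..k}" for e
    by (auto simp: I_def J_def traversing_def)
  \<comment> \<open>The cover condition applies to both orderings of the ends;
    \<open>insert_commute\<close> supplies the reversed one for \<open>J e\<close>.\<close>
  have card: "card (I e) = l" "card (J e) = l" if "e \<in> medges G" for e
    using assms(6) that ends[OF that]
    by (auto simp: I_def J_def traversing_def oriented_cycle_cover_def insert_commute)
  have disj: "I e \<inter> J e = {}" if "e \<in> medges G" for e
    using neq[OF that] by (auto simp: I_def J_def traversing_def)
  \<comment> \<open>Coefficients 1, -1 and 0 let the index range over \<open>{1..k}\<close> for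
    every edge, so that the sums over edges and cycles can be interchanged later.\<close>
  have f_eq: "f e = (\<Sum>i=1..k. (of_bool (i \<in> I e) - of_bool (i \<in> J e)) *\<^sub>R P i)" for e
  proof -
    have "(\<Sum>i\<in>A. P i) = (\<Sum>i=1..k. of_bool (i \<in> A) *\<^sub>R P i)" if "A \<subseteq> {1..k}" for A
      using that by (intro sum.mono_neutral_cong_left) auto
    with sub show ?thesis
      by (simp add: f_def scaleR_left_diff_distrib sum_subtractf)
  qed
  \<comment> \<open>Reversing an arc negates its incidence entry. The coefficient -1 for a backward
    traversal cancels this, so the choice of \<open>D\<close> disappears and only the direction in
    \<open>C i\<close> remains.\<close>
  have sign: "arc_sign D e v * (of_bool (i \<in> I e) - of_bool (i \<in> J e))
      = (if e \<in> arcs (C i) then arc_sign (C i) e v else 0)"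
    if "e \<in> medges G" "i \<in> {1..k}" for e i v
  proof (cases "e \<in> arcs (C i)")
    case True
    then have "{tail (C i) e, head (C i) e} = {tail D e, head D e}"
      using directed_cycle_in_arcs(2)[OF cyc[OF that(2)]] ends[OF that(1)] by simp
    then consider "tail (C i) e = tail D e" "head (C i) e = head D e"
      | "tail (C i) e = head D e" "head (C i) e = tail D e"
      by (auto simp: doubleton_eq_iff)
    then show ?thesis
      using True that neq[OF that(1)]
      by cases (auto simp: I_def J_def traversing_def arc_sign_def)
  qed (simp add: I_def J_def traversing_def)
  have "(\<Sum>e\<in>out_arcs D v. f e) - (\<Sum>e\<in>in_arcs D v. f e) = 0" for v
  proof -
    have "(\<Sum>e\<in>out_arcs D v. f e) - (\<Sum>e\<in>in_arcs D v. f e)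
        = (\<Sum>e\<in>medges G. arc_sign D e v *\<^sub>R f e)"
      using net_outflow_eq_arc_sign[of D] fin by (simp add: arcs_D)
    also have "\<dots> = (\<Sum>e\<in>medges G. \<Sum>i=1..k. (if e \<in> arcs (C i) then arc_sign (C i) e v else 0) *\<^sub>R P i)"
      unfolding f_eq scaleR_sum_right scaleR_scaleR
      by (intro sum.cong refl) (simp only: sign)
    \<comment> \<open>Interchanging the sums makes the coefficient of each \<open>P i\<close> the
      net outflow of \<open>C i\<close> at \<open>v\<close>, which is zero whatever the vectors
      are.\<close>
    also have "\<dots> = (\<Sum>i=1..k. (\<Sum>e\<in>medges G. if e \<in> arcs (C i) then arc_sign (C i) e v else 0) *\<^sub>R P i)"
      by (subst sum.swap) (simp only: scaleR_sum_left)
    also have "\<dots> = (\<Sum>i=1..k. (\<Sum>e\<in>arcs (C i). arc_sign (C i) e v) *\<^sub>R P i)"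
      by (intro sum.cong refl arg_cong2[where f = scaleR] sum.mono_neutral_cong_right fin
          directed_cycle_in_arcs(1)[OF cyc]) auto
    also have "\<dots> = 0"
      by (intro sum.neutral ballI) (simp add: directed_cycle_in_balanced[OF cyc])
    finally show ?thesis .
  qed
  moreover have "f e \<in> {(\<Sum>i\<in>I. P i) - (\<Sum>j\<in>J. P j) | I J.
      I \<subseteq> {1..k} \<and> J \<subseteq> {1..k} \<and> card I = l \<and> card J = l \<and> I \<inter> J = {}}"
    if "e \<in> medges G" for e
    unfolding f_def using sub card[OF that] disj[OF that] by blast
  ultimately show ?thesis
    using D unfolding vector_flow_def by blast
qed

end
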